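(* Let $V$ be a real vector space of dimension $2n+1$, and let $(b_1,\psi_1)$ and $(b_2,\psi_2)$ be two cosymplectic structures on $V$. Let $U$ be a subspace of $V$ which is Lagrangian-like for both $(b_1,\psi_1)$ and $(b_2,\psi_2)$, and let $W$ be any complement to $U$ in $V$. Then one can canonically construct (from these data) a linear isomorphism $L:V\to V$ such that $L_{|U}=\mathrm{Id}_U$, $L^*\psi_2=\psi_1$ and $L^*b_2=b_1$.
   Context: A cosymplectic structure on a finite-dimensional real vector space $V$ is a pair $(b,\psi)$ of an antisymmetric bilinear form $b$ and a nonzero linear form $\psi$ such that $\widetilde I_{\psi,b}:V\to V^*$, $\widetilde I_{\psi,b}(v)(u)=b(v,u)+\psi(v)\psi(u)$, is bijective. The Reeb vector $\xi$ is the vector with $\psi(\xi)=1$ and $b(\xi,\cdot)=0$. For $F\subset V$ put $F^{b,\psi}=\{x\in V:\widetilde I_{\psi,b}(x)(y)=0\ \forall y\in F\}$. A proper subspace $F$ is cosymplectically isotropic if $\widetilde I_{\psi,b}(x)(y)=0$ for all $x,y\in F$, and Lagrangian-like if it is cosymplectically isotropic, does not contain $\xi$, and $F^{b,\psi}=\langle\xi\rangle\oplus F$. *)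

theory Defs
  imports "HOL-Analysis.Analysis"
begin

definition flat_map :: "('v \<Rightarrow> 'v \<Rightarrow> real) \<Rightarrow> ('v \<Rightarrow> real) \<Rightarrow> 'v \<Rightarrow> 'v \<Rightarrow> real" where
  "flat_map b \<psi> v = (\<lambda>u. b v u + \<psi> v * \<psi> u)"

text \<open>The dual space is represented by the set of linear functionals.\<close>

definition cosymplectic ::
    "('v::real_vector \<Rightarrow> 'v \<Rightarrow> real) \<Rightarrow> ('v \<Rightarrow> real) \<Rightarrow> bool" where
  "cosymplectic b \<psi> \<longleftrightarrow>
     bilinear b \<and> (\<forall>x y. b x y = - b y x) \<and>
     linear \<psi> \<and> \<psi> \<noteq> (\<lambda>x. 0) \<and>
     bij_betw (flat_map b \<psi>) UNIV {f :: 'v \<Rightarrow> real. linear f}"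

text \<open>Only meaningful for a cosymplectic pair on a finite-dimensional space, where the
  described vector exists and is unique.\<close>

definition reeb :: "('v \<Rightarrow> 'v \<Rightarrow> real) \<Rightarrow> ('v \<Rightarrow> real) \<Rightarrow> 'v" where
  "reeb b \<psi> = (THE \<xi>. \<psi> \<xi> = 1 \<and> (\<forall>u. b \<xi> u = 0))"

definition cosymp_orth ::
    "('v \<Rightarrow> 'v \<Rightarrow> real) \<Rightarrow> ('v \<Rightarrow> real) \<Rightarrow> 'v set \<Rightarrow> 'v set" where
  "cosymp_orth b \<psi> F = {x. \<forall>y\<in>F. flat_map b \<psi> x y = 0}"

definition internal_direct_sum :: "'v::real_vector set \<Rightarrow> 'v set \<Rightarrow> 'v set \<Rightarrow> bool" where
  "internal_direct_sum A B C \<longleftrightarrow>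
     subspace A \<and> subspace B \<and> A \<inter> B = {0} \<and> C = {x + y |x y. x \<in> A \<and> y \<in> B}"

definition cosymp_isotropic ::
    "('v::real_vector \<Rightarrow> 'v \<Rightarrow> real) \<Rightarrow> ('v \<Rightarrow> real) \<Rightarrow> 'v set \<Rightarrow> bool" where
  "cosymp_isotropic b \<psi> F \<longleftrightarrow>
     subspace F \<and> F \<noteq> UNIV \<and> (\<forall>x\<in>F. \<forall>y\<in>F. flat_map b \<psi> x y = 0)"

definition lagrangian_like ::
    "('v::real_vector \<Rightarrow> 'v \<Rightarrow> real) \<Rightarrow> ('v \<Rightarrow> real) \<Rightarrow> 'v set \<Rightarrow> bool" where
  "lagrangian_like b \<psi> F \<longleftrightarrow>
     cosymp_isotropic b \<psi> F \<and> reeb b \<psi> \<notin> F \<and>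
     internal_direct_sum (span {reeb b \<psi>}) F (cosymp_orth b \<psi> F)"

definition lagrangian_data ::
    "('v::real_vector \<Rightarrow> 'v \<Rightarrow> real) \<Rightarrow> ('v \<Rightarrow> real) \<Rightarrow>
     ('v \<Rightarrow> 'v \<Rightarrow> real) \<Rightarrow> ('v \<Rightarrow> real) \<Rightarrow> 'v set \<Rightarrow> 'v set \<Rightarrow> bool" where
  "lagrangian_data b1 \<psi>1 b2 \<psi>2 U W \<longleftrightarrow>
     cosymplectic b1 \<psi>1 \<and> cosymplectic b2 \<psi>2 \<and>
     lagrangian_like b1 \<psi>1 U \<and> lagrangian_like b2 \<psi>2 U \<and>
     internal_direct_sum U W UNIV"

text \<open>A construction of a linear endomorphism from such data is canonical if it involves no
  choice beyond the data, i.e. if it is natural: whenever a linear automorphism \<open>g\<close> carries one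
  tuple of data to another, it conjugates the associated endomorphisms. (Any two spaces of
  the same dimension are isomorphic, so a construction equivariant under automorphisms of a
  single space extends uniquely to one natural in all isomorphisms between such spaces.)\<close>

definition canonical_construction ::
    "(('v::real_vector \<Rightarrow> 'v \<Rightarrow> real) \<Rightarrow> ('v \<Rightarrow> real) \<Rightarrow>
      ('v \<Rightarrow> 'v \<Rightarrow> real) \<Rightarrow> ('v \<Rightarrow> real) \<Rightarrow> 'v set \<Rightarrow> 'v set \<Rightarrow> 'v \<Rightarrow> 'v) \<Rightarrow> bool" where
  "canonical_construction \<Phi> \<longleftrightarrow>
     (\<forall>b1 \<psi>1 b2 \<psi>2 U W b1' \<psi>1' b2' \<psi>2' U' W' g.
        lagrangian_data b1 \<psi>1 b2 \<psi>2 U W \<and> lagrangian_data b1' \<psi>1' b2' \<psi>2' U' W' \<and>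
        linear g \<and> bij g \<and>
        (\<forall>x y. b1' (g x) (g y) = b1 x y) \<and> (\<forall>x. \<psi>1' (g x) = \<psi>1 x) \<and>
        (\<forall>x y. b2' (g x) (g y) = b2 x y) \<and> (\<forall>x. \<psi>2' (g x) = \<psi>2 x) \<and>
        g ` U = U' \<and> g ` W = W'
        \<longrightarrow> \<Phi> b1' \<psi>1' b2' \<psi>2' U' W' \<circ> g = g \<circ> \<Phi> b1 \<psi>1 b2 \<psi>2 U W)"

end

theory Submission
  imports Defs
begin

text \<open>A cosymplectic pair restricts to a symplectic form on \<open>ker \<psi>\<close> in which \<open>U\<close> is Lagrangian.
  As in the symplectic case, averaging the complement \<open>W\<close> yields an isotropic complement of \<open>U\<close>
  in \<open>ker \<psi>\<close>; let \<open>\<pi>\<close> be the projection onto \<open>U\<close> that kills it and the Reeb vector \<open>\<xi>\<close>. Then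
  \<open>x \<mapsto> (\<psi> x, b x restricted to U, \<pi> x)\<close> identifies \<open>V\<close> with \<open>\<real> \<times> U* \<times> U\<close>, and \<open>b\<close> can be
  recovered from these coordinates because \<open>b x y = b (\<pi> x) y + b x (\<pi> y)\<close>. Composing the
  coordinates of the first structure with the inverse coordinates of the second one gives \<open>L\<close>.
  Every object involved is the unique solution of a condition on the data, whence naturality.\<close>

definition proj_along :: "'v::real_vector set \<Rightarrow> 'v set \<Rightarrow> 'v \<Rightarrow> 'v" where
  "proj_along U W x = (THE u. u \<in> U \<and> x - u \<in> W)"

definition horizontal ::
    "('v::real_vector \<Rightarrow> 'v \<Rightarrow> real) \<Rightarrow> ('v \<Rightarrow> real) \<Rightarrow> 'v \<Rightarrow> 'v" where
  "horizontal b \<psi> x = x - \<psi> x *\<^sub>R reeb b \<psi>"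

text \<open>With \<open>x\<close> and \<open>y\<close> horizontal, \<open>p\<close> the projection along \<open>W\<close> and \<open>P = 1 - p\<close>, the defining
  condition reads \<open>b (\<pi> x) y = b (p x) (P y) + b (P x) (P y) / 2\<close>: the second term is what
  makes the kernel of \<open>\<pi>\<close> isotropic.\<close>

definition lagrangian_proj ::
    "('v::real_vector \<Rightarrow> 'v \<Rightarrow> real) \<Rightarrow> ('v \<Rightarrow> real) \<Rightarrow> 'v set \<Rightarrow> 'v set \<Rightarrow> 'v \<Rightarrow> 'v" where
  "lagrangian_proj b \<psi> U W x = (THE u. u \<in> U \<and>
     (\<forall>y. b u y = b (horizontal b \<psi> x + proj_along U W (horizontal b \<psi> x))
                    (horizontal b \<psi> y - proj_along U W (horizontal b \<psi> y)) / 2))"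

definition coordinate_transfer ::
    "('v::real_vector \<Rightarrow> 'v \<Rightarrow> real) \<Rightarrow> ('v \<Rightarrow> real) \<Rightarrow>
     ('v \<Rightarrow> 'v \<Rightarrow> real) \<Rightarrow> ('v \<Rightarrow> real) \<Rightarrow> 'v set \<Rightarrow> 'v set \<Rightarrow> 'v \<Rightarrow> 'v" where
  "coordinate_transfer b1 \<psi>1 b2 \<psi>2 U W x = (THE z. \<psi>2 z = \<psi>1 x \<and> (\<forall>u\<in>U. b2 z u = b1 x u) \<and>
     lagrangian_proj b2 \<psi>2 U W z = lagrangian_proj b1 \<psi>1 U W x)"

section \<open>Projection along a complement\<close>

locale complementary_subspaces =
  fixes U W :: "'v::real_vector set"
  assumes direct_sum: "internal_direct_sum U W UNIV"
begin

abbreviation "p \<equiv> proj_along U W"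

lemma subspace_U: "subspace U" and subspace_W: "subspace W" and Int_eq: "U \<inter> W = {0}"
  using direct_sum by (auto simp: internal_direct_sum_def)

lemma proj_unique:
  assumes "u \<in> U" "x - u \<in> W" "v \<in> U" "x - v \<in> W"
  shows "u = v"
proof -
  have "u - v \<in> U" using assms subspace_U by (simp add: subspace_diff)
  moreover have "(x - v) - (x - u) \<in> W" using assms subspace_W by (blast intro: subspace_diff)
  ultimately have "u - v \<in> U \<inter> W" by simp
  then show ?thesis using Int_eq by simp
qed

lemma proj_eqI: "u \<in> U \<Longrightarrow> x - u \<in> W \<Longrightarrow> p x = u"
  unfolding proj_along_def using proj_unique by blast

lemma proj_in: "p x \<in> U" and proj_diff_in: "x - p x \<in> W"
proof -
  obtain u w where "x = u + w" "u \<in> U" "w \<in> W"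
    using direct_sum unfolding internal_direct_sum_def by blast
  then have "u \<in> U" "x - u \<in> W" by simp_all
  then show "p x \<in> U" "x - p x \<in> W" using proj_eqI by auto
qed

lemma proj_of_mem: "u \<in> U \<Longrightarrow> p u = u"
  using subspace_W by (intro proj_eqI) (auto simp: subspace_0)

lemma linear_proj: "linear p"
proof (rule linearI)
  fix x y
  show "p (x + y) = p x + p y"
  proof (rule proj_eqI)
    show "p x + p y \<in> U" using proj_in subspace_U by (simp add: subspace_add)
    have "(x - p x) + (y - p y) \<in> W" using proj_diff_in subspace_W by (blast intro: subspace_add)
    then show "x + y - (p x + p y) \<in> W" by (simp add: algebra_simps)
  qed
next
  fix c x
  show "p (c *\<^sub>R x) = c *\<^sub>R p x"
  proof (rule proj_eqI)
    show "c *\<^sub>R p x \<in> U" using proj_in subspace_U by (simp add: subspace_scale)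
    show "c *\<^sub>R x - c *\<^sub>R p x \<in> W"
      using proj_diff_in[of x] subspace_W subspace_scale[of W "x - p x" c]
      by (simp add: scaleR_diff_right)
  qed
qed

end

lemma proj_along_natural:
  assumes "complementary_subspaces U W" "complementary_subspaces (g ` U) (g ` W)" "linear g"
  shows "proj_along (g ` U) (g ` W) (g x) = g (proj_along U W x)"
proof (rule complementary_subspaces.proj_eqI[OF assms(2)])
  show "g (proj_along U W x) \<in> g ` U"
    using complementary_subspaces.proj_in[OF assms(1)] by blast
  show "g x - g (proj_along U W x) \<in> g ` W"
    using complementary_subspaces.proj_diff_in[OF assms(1)]
    unfolding linear_diff[OF assms(3), symmetric] by (rule imageI)
qed

section \<open>One cosymplectic pair with a Lagrangian-like subspace, and its Reeb vector\<close>

locale lagrangian_splitting = complementary_subspaces U W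
  for U W :: "'v::real_vector set" +
  fixes b :: "'v \<Rightarrow> 'v \<Rightarrow> real" and \<psi> :: "'v \<Rightarrow> real"
  assumes cosymplectic: "cosymplectic b \<psi>" and lagrangian_like: "lagrangian_like b \<psi> U"
begin

abbreviation "\<xi> \<equiv> reeb b \<psi>"
abbreviation "h \<equiv> horizontal b \<psi>"
abbreviation "\<pi> \<equiv> lagrangian_proj b \<psi> U W"

lemma bilinear_b: "bilinear b" and b_antisym: "b x y = - b y x" and linear_psi: "linear \<psi>"
  using cosymplectic unfolding cosymplectic_def by blast+

lemma bij_flat: "bij_betw (flat_map b \<psi>) UNIV {f. linear f}"
  using cosymplectic unfolding cosymplectic_def by blast

lemmas b_simps = bilinear_ladd[OF bilinear_b] bilinear_radd[OF bilinear_b]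
  bilinear_lsub[OF bilinear_b] bilinear_rsub[OF bilinear_b]
  bilinear_lmul[OF bilinear_b] bilinear_rmul[OF bilinear_b]
  bilinear_lzero[OF bilinear_b] bilinear_rzero[OF bilinear_b]

lemmas psi_simps = linear_add[OF linear_psi] linear_diff[OF linear_psi]
  linear_scale[OF linear_psi] linear_0[OF linear_psi]

lemma b_self: "b x x = 0"
  using b_antisym[of x x] by simp

lemma flat_surj:
  assumes "linear f"
  obtains x where "\<And>y. b x y + \<psi> x * \<psi> y = f y"
proof -
  have "f \<in> flat_map b \<psi> ` UNIV"
    using bij_flat assms by (auto simp: bij_betw_def)
  then show ?thesis using that by (auto simp: flat_map_def fun_eq_iff)
qed

lemma flat_inj:
  assumes "\<And>y. b x y + \<psi> x * \<psi> y = b x' y + \<psi> x' * \<psi> y"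
  shows "x = x'"
proof -
  have "inj (flat_map b \<psi>)" using bij_flat by (simp add: bij_betw_def)
  then show ?thesis using assms by (auto simp: flat_map_def inj_def fun_eq_iff)
qed

text \<open>On the diagonal \<open>b u u = 0\<close>, so isotropy leaves only
  \<open>\<psi> u * \<psi> u = 0\<close>.\<close>

lemma psi_U: "u \<in> U \<Longrightarrow> \<psi> u = 0"
  using lagrangian_like b_self
  by (fastforce simp: lagrangian_like_def cosymp_isotropic_def flat_map_def)

lemma b_U: "u \<in> U \<Longrightarrow> v \<in> U \<Longrightarrow> b u v = 0"
  using lagrangian_like psi_U
  by (fastforce simp: lagrangian_like_def cosymp_isotropic_def flat_map_def)

text \<open>As \<psi> vanishes on \<open>U\<close>, the cosymplectic orthogonal of \<open>U\<close>
  is its orthogonal for \<open>b\<close> alone.\<close>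

lemma orth_U_eq: "{x. \<forall>u\<in>U. b x u = 0} = {c *\<^sub>R \<xi> + u | c u. u \<in> U}"
proof -
  have "cosymp_orth b \<psi> U = {x. \<forall>u\<in>U. b x u = 0}"
    using psi_U by (auto simp: cosymp_orth_def flat_map_def)
  moreover have "cosymp_orth b \<psi> U = {x + y |x y. x \<in> span {\<xi>} \<and> y \<in> U}"
    using lagrangian_like by (simp add: lagrangian_like_def internal_direct_sum_def)
  moreover have "\<dots> = {c *\<^sub>R \<xi> + u | c u. u \<in> U}" by (auto simp: span_singleton)
  ultimately show ?thesis by simp
qed

lemma reeb_notin: "\<xi> \<notin> U"
  using lagrangian_like by (simp add: lagrangian_like_def)

lemma b_orth_reeb:
  assumes "\<And>u. u \<in> U \<Longrightarrow> b x u = 0"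
  shows "b x \<xi> = 0"
proof -
  obtain c u where cu: "x = c *\<^sub>R \<xi> + u" "u \<in> U" using assms orth_U_eq by blast
  have "\<xi> \<in> {c *\<^sub>R \<xi> + u | c u. u \<in> U}"
    using subspace_0[OF subspace_U] by (intro CollectI exI[of _ 1] exI[of _ 0]) simp
  then have "b \<xi> u = 0" using cu orth_U_eq by blast
  then show ?thesis using cu b_antisym[of u \<xi>] by (simp add: b_simps b_self)
qed

text \<open>A vector representing a functional that kills \<open>U\<close> is orthogonal to
  \<open>U\<close>, hence to \<xi>. If \<open>\<psi> \<xi>\<close> were 0, that functional would
  have to vanish at \<xi> too.\<close>

lemma psi_reeb_nonzero: "\<psi> \<xi> \<noteq> 0"
proof -
  have ne: "\<xi> - p \<xi> \<noteq> 0" using reeb_notin proj_in[of \<xi>] by auto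
  then obtain f :: "'v \<Rightarrow> real" where f: "linear f" "f (\<xi> - p \<xi>) = 1"
    using linear_independent_extend[of "{\<xi> - p \<xi>}" "\<lambda>_. 1::real"] by auto
  \<comment> \<open>Composing with \<open>1 - p\<close> makes the functional zero on
    \<open>U\<close> and 1 at \<xi>.\<close>
  have "linear (\<lambda>x. f (x - p x))"
    using linear_compose[OF linear_compose_sub[OF linear_ident linear_proj] f(1)] by (simp add: o_def)
  then obtain x where x: "\<And>y. b x y + \<psi> x * \<psi> y = f (y - p y)" by (rule flat_surj) blast
  have "b x u = 0" if "u \<in> U" for u
    using x[of u] that by (simp add: psi_U proj_of_mem linear_0[OF f(1)])
  then have "b x \<xi> = 0" by (rule b_orth_reeb)
  then show ?thesis using x[of \<xi>] f by auto
qed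

text \<open>That the definite description in \<^const>\<open>reeb\<close> denotes follows here from the existence
  of a Lagrangian-like subspace, which excludes the even-dimensional counterexamples.\<close>

lemma psi_reeb: "\<psi> \<xi> = 1" and b_reeb: "b \<xi> y = 0"
  and reeb_unique: "\<psi> x = 1 \<Longrightarrow> (\<And>u. b x u = 0) \<Longrightarrow> x = \<xi>"
proof -
  have uniq: "x = z" if "\<psi> x = 1" "\<And>u. b x u = 0" "\<psi> z = 1" "\<And>u. b z u = 0" for x z
    using that by (intro flat_inj) simp
  \<comment> \<open>The candidate is the vector representing \<psi> itself; evaluating at \<xi> and
    cancelling \<open>\<psi> \<xi>\<close> gives \<open>\<psi> x = 1\<close>.\<close>
  obtain x where x: "\<And>y. b x y + \<psi> x * \<psi> y = \<psi> y"
    using flat_surj[OF linear_psi] by blast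
  have "b x u = 0" if "u \<in> U" for u
    using x[of u] that by (simp add: psi_U)
  then have "b x \<xi> = 0" by (rule b_orth_reeb)
  then have x1: "\<psi> x = 1" using x[of \<xi>] psi_reeb_nonzero by simp
  then have x0: "b x y = 0" for y using x[of y] by simp
  have "\<xi> = x" unfolding reeb_def using x1 x0 uniq by (intro the_equality) blast+
  then show "\<psi> \<xi> = 1" "b \<xi> y = 0" using x0 x1 by auto
  show "z = \<xi>" if "\<psi> z = 1" "\<And>u. b z u = 0" for z
    using uniq[OF that] x0 x1 \<open>\<xi> = x\<close> by blast
qed

section \<open>Horizontal parts and duality for \<open>U\<close>\<close>

lemma b_reeb_right: "b y \<xi> = 0"
  using b_antisym[of y \<xi>] b_reeb by simp

lemma linear_horizontal: "linear h"
  unfolding horizontal_def by (rule linearI) (simp_all add: psi_simps algebra_simps)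

lemma horizontal_U: "u \<in> U \<Longrightarrow> h u = u"
  by (simp add: horizontal_def psi_U)

lemma horizontal_reeb: "h \<xi> = 0"
  by (simp add: horizontal_def psi_reeb)

lemma b_horizontal: "b (h x) (h y) = b x y"
  by (simp add: horizontal_def b_simps b_reeb b_reeb_right)

text \<open>On \<open>U\<close> the injective \<open>flat_map\<close> reduces to \<open>b\<close>;
  this is the uniqueness behind \<open>lagrangian_proj\<close>.\<close>

lemma U_eqI:
  assumes "u \<in> U" "v \<in> U" "\<And>y. b u y = b v y"
  shows "u = v"
  using assms psi_U by (intro flat_inj) simp

text \<open>The representing vector has \<open>\<psi> a = f \<xi> = 0\<close> and is orthogonal to
  \<open>U\<close>, so its component along \<xi> vanishes and it lies in \<open>U\<close>. This is
  the existence behind \<open>lagrangian_proj\<close>.\<close>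

lemma U_represents:
  assumes "linear f" "\<And>u. u \<in> U \<Longrightarrow> f u = 0" "f \<xi> = 0"
  shows "\<exists>a\<in>U. \<forall>y. b a y = f y"
proof -
  obtain a where a: "\<And>y. b a y + \<psi> a * \<psi> y = f y" using flat_surj[OF assms(1)] by blast
  have psi: "\<psi> a = 0" using a[of \<xi>] by (simp add: b_reeb_right psi_reeb assms)
  have "b a u = 0" if "u \<in> U" for u using a[of u] psi assms(2) that by simp
  then obtain c u where "a = c *\<^sub>R \<xi> + u" "u \<in> U" using orth_U_eq by blast
  moreover from this have "c = 0" using psi by (simp add: psi_simps psi_reeb psi_U)
  ultimately show ?thesis using a psi by auto
qed

section \<open>The projection onto \<open>U\<close> with isotropic kernel\<close>

lemma lagrangian_proj_eqI:
  assumes "u \<in> U" "\<And>y. b u y = b (h x + p (h x)) (h y - p (h y)) / 2"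
  shows "\<pi> x = u"
  unfolding lagrangian_proj_def
proof (rule the_equality)
  fix v assume "v \<in> U \<and> (\<forall>y. b v y = b (h x + p (h x)) (h y - p (h y)) / 2)"
  then show "v = u" using assms by (intro U_eqI) (simp_all only:)
qed (use assms in simp)

lemma lagrangian_proj_in: "\<pi> x \<in> U"
  and b_lagrangian_proj: "b (\<pi> x) y = b (h x + p (h x)) (h y - p (h y)) / 2"
proof -
  let ?f = "\<lambda>y. b (h x + p (h x)) (h y - p (h y)) / 2"
  have "linear ?f"
    by (rule linearI)
      (simp_all add: linear_add[OF linear_horizontal] linear_scale[OF linear_horizontal]
        linear_add[OF linear_proj] linear_scale[OF linear_proj] b_simps field_simps)
  moreover have "?f u = 0" if "u \<in> U" for u
    using that by (simp add: horizontal_U proj_of_mem b_simps)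
  moreover have "?f \<xi> = 0"
    by (simp add: horizontal_reeb linear_0[OF linear_proj] b_simps)
  ultimately obtain a where "a \<in> U" "\<And>y. b a y = ?f y" using U_represents[of ?f] by blast
  moreover from this have "\<pi> x = a" by (rule lagrangian_proj_eqI)
  ultimately show "\<pi> x \<in> U" "b (\<pi> x) y = ?f y" by auto
qed

lemma linear_lagrangian_proj: "linear \<pi>"
proof (rule linearI)
  show "\<pi> (x + y) = \<pi> x + \<pi> y" for x y
    by (rule lagrangian_proj_eqI)
      (simp_all add: subspace_add[OF subspace_U] lagrangian_proj_in b_lagrangian_proj b_simps
        linear_add[OF linear_horizontal] linear_add[OF linear_proj] field_simps)
  show "\<pi> (c *\<^sub>R x) = c *\<^sub>R \<pi> x" for c x
    by (rule lagrangian_proj_eqI)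
      (simp_all add: subspace_scale[OF subspace_U] lagrangian_proj_in b_lagrangian_proj b_simps
        linear_scale[OF linear_horizontal] linear_scale[OF linear_proj] field_simps)
qed

text \<open>For \<open>u\<close> in \<open>U\<close> the first argument in the defining condition
  becomes \<open>2 u\<close>, which cancels the factor 1/2, and \<open>p (h y)\<close> drops out by
  isotropy.\<close>

lemma lagrangian_proj_U: "u \<in> U \<Longrightarrow> \<pi> u = u"
proof (rule lagrangian_proj_eqI)
  fix y assume u: "u \<in> U"
  have "b u y = b u (h y)" using b_horizontal[of u y] u by (simp add: horizontal_U)
  then show "b u y = b (h u + p (h u)) (h y - p (h y)) / 2"
    using u by (simp add: horizontal_U proj_of_mem b_simps b_U proj_in)
qed

lemma lagrangian_proj_reeb: "\<pi> \<xi> = 0"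
  by (rule lagrangian_proj_eqI)
    (simp_all add: subspace_0[OF subspace_U] horizontal_reeb linear_0[OF linear_proj] b_simps)

text \<open>Antisymmetrising the defining condition adds the two halves of the
  \<open>P\<close>-\<open>P\<close> term and yields both mixed terms; the missing
  \<open>p\<close>-\<open>p\<close> term is zero by isotropy of \<open>U\<close>. In particular
  \<open>b\<close> vanishes on the kernel of \<open>\<pi>\<close>.\<close>

lemma b_decomp: "b x y = b (\<pi> x) y + b x (\<pi> y)"
proof -
  have "b (\<pi> x) y + b x (\<pi> y) = b (\<pi> x) y - b (\<pi> y) x"
    using b_antisym[of x "\<pi> y"] by simp
  also have "\<dots> = b (h x) (h y)"
    using b_antisym[of "h y" "h x"] b_antisym[of "p (h y)" "h x"] b_antisym[of "h y" "p (h x)"]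
    by (simp add: b_lagrangian_proj b_simps b_U proj_in field_simps)
  finally show ?thesis by (simp add: b_horizontal)
qed

section \<open>Bijectivity of the coordinates\<close>

lemma coordinates_inj:
  assumes "\<psi> x = \<psi> z" "\<And>u. u \<in> U \<Longrightarrow> b x u = b z u" "\<pi> x = \<pi> z"
  shows "x = z"
proof -
  have "\<forall>u\<in>U. b (x - z) u = 0" using assms(2) by (simp add: b_simps)
  then obtain c u where cu: "x - z = c *\<^sub>R \<xi> + u" "u \<in> U" using orth_U_eq by blast
  \<comment> \<open>\<psi> reads off the Reeb coefficient, so the difference lies in
    \<open>U\<close>, where \<open>\<pi>\<close> is the identity.\<close>
  have "c = \<psi> (c *\<^sub>R \<xi> + u)" using cu(2) by (simp add: psi_simps psi_reeb psi_U)
  also have "\<dots> = 0" unfolding cu(1)[symmetric] using assms(1) by (simp add: psi_simps)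
  finally have "x - z = u" using cu(1) by simp
  moreover have "\<pi> (x - z) = 0" using assms(3) by (simp add: linear_diff[OF linear_lagrangian_proj])
  ultimately have "x - z = 0" using lagrangian_proj_U[OF cu(2)] by metis
  then show ?thesis by simp
qed

lemma coordinates_surj:
  assumes "linear f" "v \<in> U"
  obtains z where "\<psi> z = t" "\<forall>u\<in>U. b z u = f u" "\<pi> z = v"
proof -
  \<comment> \<open>Only the values of \<open>f\<close> on \<open>U\<close> matter, and
    \<open>p\<close> fixes these.\<close>
  have "linear (\<lambda>y. f (p y))" using linear_compose[OF linear_proj assms(1)] by (simp add: o_def)
  then obtain x where x: "\<And>y. b x y + \<psi> x * \<psi> y = f (p y)" by (rule flat_surj) blast
  \<comment> \<open>Both corrections are orthogonal to \<open>U\<close>: the multiple of \<xi>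
    adjusts only \<psi>, the vector of \<open>U\<close> only \<open>\<pi>\<close>.\<close>
  define z where "z = x + (t - \<psi> x) *\<^sub>R \<xi> + (v - \<pi> x)"
  have v: "v - \<pi> x \<in> U" using assms(2) lagrangian_proj_in subspace_U by (simp add: subspace_diff)
  have "\<psi> z = t" using psi_U[OF v] by (simp add: z_def psi_simps psi_reeb)
  moreover have "b z u = f u" if "u \<in> U" for u
    using x[of u] b_U[OF v that] that by (simp add: z_def b_simps b_reeb psi_U proj_of_mem)
  moreover have "\<pi> z = v"
    using lagrangian_proj_U[OF v] linear_lagrangian_proj
    by (simp add: z_def linear_add linear_diff linear_scale lagrangian_proj_reeb)
  ultimately show ?thesis using that by blast
qed

end

section \<open>Naturality of the Reeb vector and the projection\<close>

lemma reeb_natural: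
  assumes "lagrangian_splitting U W b \<psi>" "lagrangian_splitting (g ` U) (g ` W) b' \<psi>'"
    and "bij g" "\<And>x y. b' (g x) (g y) = b x y" "\<And>x. \<psi>' (g x) = \<psi> x"
  shows "g (reeb b \<psi>) = reeb b' \<psi>'"
proof (rule lagrangian_splitting.reeb_unique[OF assms(2)])
  show "\<psi>' (g (reeb b \<psi>)) = 1"
    using lagrangian_splitting.psi_reeb[OF assms(1)] assms(5) by simp
  show "b' (g (reeb b \<psi>)) u = 0" for u
    using lagrangian_splitting.b_reeb[OF assms(1)] assms(3,4) by (metis bij_pointE)
qed

lemma lagrangian_proj_natural:
  assumes S: "lagrangian_splitting U W b \<psi>" and S': "lagrangian_splitting (g ` U) (g ` W) b' \<psi>'"
    and g: "linear g" "bij g" "\<And>x y. b' (g x) (g y) = b x y" "\<And>x. \<psi>' (g x) = \<psi> x"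
  shows "lagrangian_proj b' \<psi>' (g ` U) (g ` W) (g x) = g (lagrangian_proj b \<psi> U W x)"
proof (rule lagrangian_splitting.lagrangian_proj_eqI[OF S'])
  show "g (lagrangian_proj b \<psi> U W x) \<in> g ` U"
    using lagrangian_splitting.lagrangian_proj_in[OF S] by blast
  have h: "horizontal b' \<psi>' (g z) = g (horizontal b \<psi> z)" for z
    using reeb_natural[OF S S' g(2-4)]
    by (simp add: horizontal_def g(4) linear_diff[OF g(1)] linear_scale[OF g(1)])
  have p: "proj_along (g ` U) (g ` W) (g z) = g (proj_along U W z)" for z
    using S S' g(1) by (intro proj_along_natural) (auto simp: lagrangian_splitting_def)
  fix y
  \<comment> \<open>The condition ranges over all \<open>y\<close>, so surjectivity of
    \<open>g\<close> is needed to pull it back.\<close>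
  obtain z where z: "y = g z" using g(2) by (metis bij_pointE)
  show "b' (g (lagrangian_proj b \<psi> U W x)) y
    = b' (horizontal b' \<psi>' (g x) + proj_along (g ` U) (g ` W) (horizontal b' \<psi>' (g x)))
         (horizontal b' \<psi>' y - proj_along (g ` U) (g ` W) (horizontal b' \<psi>' y)) / 2"
    unfolding z h p linear_add[OF g(1), symmetric] linear_diff[OF g(1), symmetric] g(3)
    by (rule lagrangian_splitting.b_lagrangian_proj[OF S])
qed

section \<open>Transfer between two cosymplectic pairs\<close>

locale lagrangian_splitting_pair =
  S1: lagrangian_splitting U W b1 \<psi>1 + S2: lagrangian_splitting U W b2 \<psi>2
  for U W :: "'v::real_vector set" and b1 \<psi>1 b2 \<psi>2
begin

abbreviation "L \<equiv> coordinate_transfer b1 \<psi>1 b2 \<psi>2 U W"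

lemma transfer_eqI:
  assumes "\<psi>2 z = \<psi>1 x" "\<And>u. u \<in> U \<Longrightarrow> b2 z u = b1 x u" "S2.\<pi> z = S1.\<pi> x"
  shows "L x = z"
  unfolding coordinate_transfer_def
  by (rule the_equality) (use assms in \<open>auto intro: S2.coordinates_inj\<close>)

lemma psi_transfer: "\<psi>2 (L x) = \<psi>1 x"
  and b_transfer_U: "u \<in> U \<Longrightarrow> b2 (L x) u = b1 x u"
  and proj_transfer: "S2.\<pi> (L x) = S1.\<pi> x"
proof -
  have "linear (b1 x)" using S1.bilinear_b by (simp add: bilinear_def)
  then obtain z where z: "\<psi>2 z = \<psi>1 x" "\<forall>u\<in>U. b2 z u = b1 x u" "S2.\<pi> z = S1.\<pi> x"
    using S2.coordinates_surj S1.lagrangian_proj_in by metis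
  then have "L x = z" by (intro transfer_eqI) auto
  then show "\<psi>2 (L x) = \<psi>1 x" "u \<in> U \<Longrightarrow> b2 (L x) u = b1 x u" "S2.\<pi> (L x) = S1.\<pi> x"
    using z by auto
qed

text \<open>In either structure \<open>u\<close> has coordinates \<open>(0, 0, u)\<close>.\<close>

lemma transfer_U: "u \<in> U \<Longrightarrow> L u = u"
  by (rule transfer_eqI)
    (simp_all add: S1.psi_U S2.psi_U S1.b_U S2.b_U S1.lagrangian_proj_U S2.lagrangian_proj_U)

text \<open>\<open>b_decomp\<close> expresses each form through pairings with vectors of
  \<open>U\<close>, which the transfer preserves along with \<open>\<pi>\<close>.\<close>

lemma b_transfer: "b2 (L x) (L y) = b1 x y"
proof -
  have "b2 (L x) (L y) = b2 (S1.\<pi> x) (L y) + b2 (L x) (S1.\<pi> y)"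
    using S2.b_decomp[of "L x" "L y"] by (simp add: proj_transfer)
  also have "\<dots> = - b1 y (S1.\<pi> x) + b1 x (S1.\<pi> y)"
    using S2.b_antisym[of "S1.\<pi> x" "L y"] by (simp add: b_transfer_U S1.lagrangian_proj_in)
  also have "\<dots> = b1 x y"
    using S1.b_decomp[of x y] S1.b_antisym[of "S1.\<pi> x" y] by simp
  finally show ?thesis .
qed

lemma linear_transfer: "linear L"
proof (rule linearI)
  show "L (x + y) = L x + L y" for x y
    by (rule transfer_eqI)
      (simp_all add: S1.psi_simps S2.psi_simps S1.b_simps S2.b_simps psi_transfer b_transfer_U
        proj_transfer linear_add[OF S1.linear_lagrangian_proj] linear_add[OF S2.linear_lagrangian_proj])
  show "L (c *\<^sub>R x) = c *\<^sub>R L x" for c x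
    by (rule transfer_eqI)
      (simp_all add: S1.psi_simps S2.psi_simps S1.b_simps S2.b_simps psi_transfer b_transfer_U
        proj_transfer linear_scale[OF S1.linear_lagrangian_proj]
        linear_scale[OF S2.linear_lagrangian_proj])
qed

text \<open>The three equations for \<open>L x\<close> are symmetric in the two structures, so
  \<open>x\<close> solves the swapped ones.\<close>

lemma transfer_inverse: "coordinate_transfer b2 \<psi>2 b1 \<psi>1 U W (L x) = x"
proof -
  interpret inv: lagrangian_splitting_pair U W b2 \<psi>2 b1 \<psi>1 ..
  show ?thesis by (rule inv.transfer_eqI) (simp_all add: psi_transfer b_transfer_U proj_transfer)
qed

lemma bij_transfer: "bij L"
proof -
  interpret inv: lagrangian_splitting_pair U W b2 \<psi>2 b1 \<psi>1 ..
  show ?thesis using transfer_inverse inv.transfer_inverse by (intro o_bij[of inv.L]) auto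
qed

end

section \<open>Naturality of the transfer and conclusion\<close>

lemma coordinate_transfer_natural:
  assumes P: "lagrangian_splitting_pair U W b1 \<psi>1 b2 \<psi>2"
    and P': "lagrangian_splitting_pair (g ` U) (g ` W) b1' \<psi>1' b2' \<psi>2'"
    and g: "linear g" "bij g"
    and g1: "\<And>x y. b1' (g x) (g y) = b1 x y" "\<And>x. \<psi>1' (g x) = \<psi>1 x"
    and g2: "\<And>x y. b2' (g x) (g y) = b2 x y" "\<And>x. \<psi>2' (g x) = \<psi>2 x"
  shows "coordinate_transfer b1' \<psi>1' b2' \<psi>2' (g ` U) (g ` W) (g x)
    = g (coordinate_transfer b1 \<psi>1 b2 \<psi>2 U W x)"
proof -
  interpret P: lagrangian_splitting_pair U W b1 \<psi>1 b2 \<psi>2 by (rule P)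
  interpret P': lagrangian_splitting_pair "g ` U" "g ` W" b1' \<psi>1' b2' \<psi>2' by (rule P')
  show ?thesis
  proof (rule P'.transfer_eqI)
    show "\<psi>2' (g (P.L x)) = \<psi>1' (g x)" by (simp add: g1 g2 P.psi_transfer)
    show "b2' (g (P.L x)) u = b1' (g x) u" if "u \<in> g ` U" for u
      using that by (auto simp: g1 g2 P.b_transfer_U)
    have "P'.S2.\<pi> (g (P.L x)) = g (P.S2.\<pi> (P.L x))"
      by (rule lagrangian_proj_natural[OF P.S2.lagrangian_splitting_axioms
            P'.S2.lagrangian_splitting_axioms g g2])
    also have "\<dots> = g (P.S1.\<pi> x)" by (simp only: P.proj_transfer)
    also have "\<dots> = P'.S1.\<pi> (g x)"
      by (rule lagrangian_proj_natural[OF P.S1.lagrangian_splitting_axioms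
            P'.S1.lagrangian_splitting_axioms g g1, symmetric])
    finally show "P'.S2.\<pi> (g (P.L x)) = P'.S1.\<pi> (g x)" .
  qed
qed

lemma lagrangian_data_iff:
  "lagrangian_data b1 \<psi>1 b2 \<psi>2 U W \<longleftrightarrow> lagrangian_splitting_pair U W b1 \<psi>1 b2 \<psi>2"
  by (auto simp: lagrangian_data_def lagrangian_splitting_pair_def lagrangian_splitting_def
      lagrangian_splitting_axioms_def complementary_subspaces_def)

theorem proposition2p14:
  fixes n :: nat
  assumes "dim (UNIV :: 'v::real_vector set) = 2 * n + 1"
  shows "\<exists>\<Phi> :: ('v \<Rightarrow> 'v \<Rightarrow> real) \<Rightarrow> ('v \<Rightarrow> real) \<Rightarrow>
              ('v \<Rightarrow> 'v \<Rightarrow> real) \<Rightarrow> ('v \<Rightarrow> real) \<Rightarrow> 'v set \<Rightarrow> 'v set \<Rightarrow> 'v \<Rightarrow> 'v.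
      canonical_construction \<Phi> \<and>
      (\<forall>b1 \<psi>1 b2 \<psi>2 U W.
         cosymplectic b1 \<psi>1 \<longrightarrow> cosymplectic b2 \<psi>2 \<longrightarrow>
         lagrangian_like b1 \<psi>1 U \<longrightarrow> lagrangian_like b2 \<psi>2 U \<longrightarrow>
         internal_direct_sum U W UNIV \<longrightarrow>
         (let L = \<Phi> b1 \<psi>1 b2 \<psi>2 U W in
            linear L \<and> bij L \<and> (\<forall>u\<in>U. L u = u) \<and>
            (\<forall>x. \<psi>2 (L x) = \<psi>1 x) \<and>
            (\<forall>x y. b2 (L x) (L y) = b1 x y)))"
proof (intro exI conjI allI impI)
  show "canonical_construction (coordinate_transfer :: ('v \<Rightarrow> 'v \<Rightarrow> real) \<Rightarrow> _)"
    unfolding canonical_construction_def lagrangian_data_iff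
    by (auto simp: fun_eq_iff intro!: coordinate_transfer_natural)
next
  fix b1 b2 :: "'v \<Rightarrow> 'v \<Rightarrow> real" and \<psi>1 \<psi>2 U W
  assume "cosymplectic b1 \<psi>1" "cosymplectic b2 \<psi>2" "lagrangian_like b1 \<psi>1 U"
    "lagrangian_like b2 \<psi>2 U" "internal_direct_sum U W UNIV"
  then interpret lagrangian_splitting_pair U W b1 \<psi>1 b2 \<psi>2
    unfolding lagrangian_data_iff[symmetric] lagrangian_data_def by blast
  show "let L = coordinate_transfer b1 \<psi>1 b2 \<psi>2 U W in
      linear L \<and> bij L \<and> (\<forall>u\<in>U. L u = u) \<and>
      (\<forall>x. \<psi>2 (L x) = \<psi>1 x) \<and> (\<forall>x y. b2 (L x) (L y) = b1 x y)"
    by (simp add: Let_def linear_transfer bij_transfer transfer_U psi_transfer b_transfer)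
qed

end
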